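(* Let $S\subset\mathbb{R}^2$ be a compact set such that $\partial S$ is path-connected and $S=\overline{\mathrm{int}(S)}$. Let $\mathcal{X}_n=\{X_1,\dots,X_n\}$ be any set of $n$ points in $S$. Then for all $\theta\in[0,\pi/2)$ the output $E_n$ of the cone-removal algorithm described in the context, applied to $\mathcal{X}_n$ with angle $\theta$, coincides with the $\theta$-biconvex hull of $\mathcal{X}_n$, that is, $E_n=\mathbb{B}_\theta(\mathcal{X}_n)$.
   Context: $\mathbb{R}^2$ carries the Euclidean norm $\|\cdot\|$ and inner product $\langle\cdot,\cdot\rangle$; $\partial$, $\mathrm{int}$, overline and superscript $c$ denote boundary, interior, closure and complement. For $\theta\in[0,\pi/2)$ put $b_1=(\cos\theta,\sin\theta)$, $b_2=(-\sin\theta,\cos\theta)$, $\xi=(b_1+b_2)/\|b_1+b_2\|$. Let $R$ be the counter-clockwise rotation of angle $\pi/2$ about the origin, $R^0(\xi)=\xi$, $R^i(\xi)=R(R^{i-1}(\xi))$. For a unit vector $v$ and $x\in\mathbb{R}^2$, $C_v(x)=\{z\neq x:\langle v,(z-x)/\|z-x\|\rangle>\cos(\pi/4)\}$ is the open quadrant with vertex $x$ and axis $v$; thus the sides of $C_{R^j(\xi)}(x)$ are half-lines parallel to $b_1$ and $b_2$. The $\theta$-biconvex hull of $A\subset\mathbb{R}^2$ is $$\mathbb{B}_\theta(A)=\bigcap\big\{(C_{R^i(\xi)}(y))^c:\ i\in\{0,1,2,3\},\ y\in\mathbb{R}^2,\ C_{R^i(\xi)}(y)\cap A=\emptyset\big\}.$$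 Algorithm. Start: $E=\mathrm{co}(\mathcal{X}_n)$, the ordinary convex hull. Iteration: for each $i=1,\dots,n-1$ consider the four cones $C_{R^j(\xi)}(X_i)$, $j=0,1,2,3$. For each of these cones $C_i$ that is empty (contains no point of $\mathcal{X}_n$): (I1) let $C_i^1$ be the "horizontal maximal empty cone", obtained by translating $C_i$ in the direction $\pm b_1$ (with the sign for which the cone is enlarged) until some other sample point is met, i.e. $C_i^1$ is the union of all those enlarging translates of $C_i$ parallel to $b_1$ that contain no point of $\mathcal{X}_n$ (a half-plane if no sample point is ever met); replace $E$ by $E\setminus C_i^1$; (I2) let $C_i^2$ be the "vertical maximal empty cone", defined in the same way with translations of $C_i$ in the direction $\pm b_2$ (with the enlarging sign); replace $E$ by $E\setminus C_i^2$. If none of the four cones is empty, nothing is removed for that $i$. Output: $E_n$ is the set $E$ obtained after all iterations. *)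

theory Defs
  imports "HOL-Analysis.Analysis"
begin

definition b1 :: "real \<Rightarrow> real ^ 2" where
  "b1 \<theta> = vector [cos \<theta>, sin \<theta>]"

definition b2 :: "real \<Rightarrow> real ^ 2" where
  "b2 \<theta> = vector [- sin \<theta>, cos \<theta>]"

definition axis_dir :: "real \<Rightarrow> real ^ 2" where
  "axis_dir \<theta> = (b1 \<theta> + b2 \<theta>) /\<^sub>R norm (b1 \<theta> + b2 \<theta>)"

text \<open>Counter-clockwise rotation by a right angle about the origin.\<close>

definition quarter_turn :: "real ^ 2 \<Rightarrow> real ^ 2" where
  "quarter_turn v = vector [- (v $ 2), v $ 1]"

definition open_quadrant :: "real ^ 2 \<Rightarrow> real ^ 2 \<Rightarrow> (real ^ 2) set" where
  "open_quadrant v x = {z. z \<noteq> x \<and> v \<bullet> ((z - x) /\<^sub>R norm (z - x)) > cos (pi / 4)}"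

definition quadrant :: "real \<Rightarrow> nat \<Rightarrow> real ^ 2 \<Rightarrow> (real ^ 2) set" where
  "quadrant \<theta> j x = open_quadrant ((quarter_turn ^^ j) (axis_dir \<theta>)) x"

definition biconvex_hull :: "real \<Rightarrow> (real ^ 2) set \<Rightarrow> (real ^ 2) set" where
  "biconvex_hull \<theta> A =
     \<Inter> {- quadrant \<theta> i y | i y. i \<in> {0, 1, 2, 3} \<and> quadrant \<theta> i y \<inter> A = {}}"

text \<open>
  The scalar \<open>t\<close> ranges over both signs; the condition that the translate contains \<open>C\<close>
  selects the sign for which the cone is enlarged.
\<close>

definition maximal_empty_cone ::
    "(real ^ 2) set \<Rightarrow> real ^ 2 \<Rightarrow> (real ^ 2) set \<Rightarrow> (real ^ 2) set" where
  "maximal_empty_cone A d C =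
     \<Union> {(+) (t *\<^sub>R d) ` C | t :: real.
          C \<subseteq> (+) (t *\<^sub>R d) ` C \<and> ((+) (t *\<^sub>R d) ` C) \<inter> A = {}}"

definition cone_removal ::
    "real \<Rightarrow> (real ^ 2) set \<Rightarrow> real ^ 2 \<Rightarrow> nat \<Rightarrow> (real ^ 2) set \<Rightarrow> (real ^ 2) set" where
  "cone_removal \<theta> A x j E =
     (let C = quadrant \<theta> j x in
      if C \<inter> A = {}
      then (E - maximal_empty_cone A (b1 \<theta>) C) - maximal_empty_cone A (b2 \<theta>) C
      else E)"

text \<open>
  The outer loop runs over the indices \<open>1, \<dots>, n - 1\<close>: the cones at the last sample point
  are not examined, although that point does count when testing emptiness.
\<close>

definition algorithm_output :: "real \<Rightarrow> nat \<Rightarrow> (nat \<Rightarrow> real ^ 2) \<Rightarrow> (real ^ 2) set" where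
  "algorithm_output \<theta> n X =
     (let A = X ` {1..n} in
      fold (\<lambda>i E. fold (cone_removal \<theta> A (X i)) [0, 1, 2, 3] E) [1..<n] (convex hull A))"

end

theory Submission imports Defs begin

text \<open>
  In coordinates along \<open>b1 \<theta>\<close> and \<open>b2 \<theta>\<close> the cones are open quadrants. A point \<open>z\<close> of the
  convex hull outside the biconvex hull lies in an empty quadrant, say the upper right one with
  vertex \<open>y\<close>. Among the sample points strictly above \<open>y\<close>, the rightmost one \<open>p\<close> has an empty
  upper right quadrant, and sliding that quadrant down to the level of \<open>y\<close> keeps it empty and makes
  it cover \<open>z\<close>. Exchanging the coordinates gives a second such point \<open>q\<close>, strictly to the right of
  \<open>y\<close>, whereas \<open>p\<close> is not. Since \<open>p\<close> and \<open>q\<close> differ, one of them is not the last sample point, so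
  \<open>z\<close> is removed although the cones at that point are skipped.
  Conversely, every removed set is a union of empty quadrants, and a point outside the convex hull
  is cut off by a half-plane, which contains a quadrant around it.
\<close>

section \<open>Quarter turns and orthonormal coordinates in the plane\<close>

lemma quarter_turn_nth [simp]: "quarter_turn v $ 1 = - (v $ 2)" "quarter_turn v $ 2 = v $ 1"
  by (simp_all add: quarter_turn_def)

lemma inner_real2: "x \<bullet> y = x $ 1 * y $ 1 + x $ 2 * y $ 2" for x y :: "real ^ 2"
  by (simp add: inner_vec_def sum_2)

lemma quarter_turn_add: "quarter_turn (v + w) = quarter_turn v + quarter_turn w"
  by (simp add: vec_eq_iff forall_2)

lemma quarter_turn_scaleR: "quarter_turn (c *\<^sub>R v) = c *\<^sub>R quarter_turn v"
  by (simp add: vec_eq_iff forall_2)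

lemma quarter_turn_minus [simp]: "quarter_turn (- v) = - quarter_turn v"
  by (simp add: vec_eq_iff forall_2)

lemma inner_quarter_turn [simp]: "quarter_turn v \<bullet> quarter_turn w = v \<bullet> w"
  by (simp add: inner_real2 add.commute)

lemma norm_quarter_turn [simp]: "norm (quarter_turn v) = norm v"
  by (simp add: norm_eq_sqrt_inner)

lemma inner_quarter_turn_self [simp]: "v \<bullet> quarter_turn v = 0" "quarter_turn v \<bullet> v = 0"
  by (simp_all add: inner_real2)

lemma quarter_turn_b1: "quarter_turn (b1 \<theta>) = b2 \<theta>"
  by (simp add: vec_eq_iff forall_2 b1_def b2_def)

lemma quarter_turn_b2: "quarter_turn (b2 \<theta>) = - b1 \<theta>"
  by (simp add: vec_eq_iff forall_2 b1_def b2_def)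

lemma norm_b1: "norm (b1 \<theta>) = 1"
  by (simp add: norm_eq_sqrt_inner inner_real2 b1_def flip: power2_eq_square)

text \<open>Parseval's identity for the orthonormal basis \<open>u\<close>,
  \<open>quarter_turn u\<close>. For arbitrary \<open>u\<close> it is a polynomial identity with the
  extra factor \<open>u \<bullet> u\<close>.\<close>

lemma inner_frame_expand:
  assumes "norm u = 1"
  shows "x \<bullet> y = (u \<bullet> x) * (u \<bullet> y) + (quarter_turn u \<bullet> x) * (quarter_turn u \<bullet> y)"
proof -
  have "(u \<bullet> x) * (u \<bullet> y) + (quarter_turn u \<bullet> x) * (quarter_turn u \<bullet> y) = (u \<bullet> u) * (x \<bullet> y)"
    by (simp add: inner_real2 algebra_simps)
  then show ?thesis using assms by (simp add: norm_eq_1)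
qed

section \<open>Cones as intersections of two half-planes\<close>

definition corner :: "'a::real_inner \<Rightarrow> 'a \<Rightarrow> 'a \<Rightarrow> 'a set" where
  "corner u w x = {z. u \<bullet> z > u \<bullet> x \<and> w \<bullet> z > w \<bullet> x}"

lemma mem_corner: "z \<in> corner u w x \<longleftrightarrow> u \<bullet> z > u \<bullet> x \<and> w \<bullet> z > w \<bullet> x"
  by (simp add: corner_def)

lemma corner_commute: "corner u w x = corner w u x"
  by (auto simp: mem_corner)

lemma translate_corner: "(+) a ` corner u w x = corner u w (a + x)"
proof (intro equalityI subsetI)
  fix z assume "z \<in> corner u w (a + x)"
  then have "z - a \<in> corner u w x"
    by (simp add: mem_corner inner_diff_right inner_add_right)
  then show "z \<in> (+) a ` corner u w x"
    by (intro image_eqI[of _ _ "z - a"]) auto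
qed (auto simp: mem_corner inner_add_right)

text \<open>The squares of \<open>a + b\<close> and \<open>r\<close> differ by
  \<open>2 * a * b\<close>; conversely, \<open>r\<close> bounds both absolute values, so a sum above
  \<open>r\<close> needs two positive terms.\<close>

lemma sum_gt_hypotenuse_iff:
  fixes a b r :: real
  assumes "r \<ge> 0" "r\<^sup>2 = a\<^sup>2 + b\<^sup>2"
  shows "a + b > r \<longleftrightarrow> a > 0 \<and> b > 0"
proof
  have "\<bar>a\<bar> \<le> r" "\<bar>b\<bar> \<le> r" using assms by (auto intro: abs_le_square_iff[THEN iffD2] power2_le_imp_le)
  then show "a > 0 \<and> b > 0" if "a + b > r" using that by linarith
  show "a + b > r" if ab: "a > 0 \<and> b > 0"
  proof (rule power2_less_imp_less)
    have "0 < a * b" using ab by simp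
    then show "r\<^sup>2 < (a + b)\<^sup>2" using assms(2) by (simp add: power2_sum)
  qed (use ab in simp)
qed

text \<open>The factor \<open>sqrt 2 / 2\<close> of the axis cancels against
  \<open>cos (pi / 4)\<close>, so the angle condition says that the coordinates of
  \<open>z - x\<close> add up to more than its norm.\<close>

lemma open_quadrant_eq_corner:
  assumes u: "norm u = 1"
  defines "w \<equiv> quarter_turn u"
  shows "open_quadrant ((sqrt 2 / 2) *\<^sub>R (u + w)) x = corner u w x"
proof (intro set_eqI)
  fix z
  define d where "d = z - x"
  have pars: "(norm d)\<^sup>2 = (u \<bullet> d)\<^sup>2 + (w \<bullet> d)\<^sup>2"
    unfolding power2_norm_eq_inner w_def
    using inner_frame_expand[OF u, of d d] by (simp add: power2_eq_square)
  show "z \<in> open_quadrant ((sqrt 2 / 2) *\<^sub>R (u + w)) x \<longleftrightarrow> z \<in> corner u w x"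
  proof (cases "d = 0")
    case True
    then show ?thesis by (simp add: d_def open_quadrant_def mem_corner)
  next
    case False
    then have pos: "norm d > 0" by simp
    have "z \<in> open_quadrant ((sqrt 2 / 2) *\<^sub>R (u + w)) x
        \<longleftrightarrow> ((sqrt 2 / 2) *\<^sub>R (u + w)) \<bullet> (d /\<^sub>R norm d) > cos (pi / 4)"
      using False by (auto simp: open_quadrant_def d_def)
    also have "((sqrt 2 / 2) *\<^sub>R (u + w)) \<bullet> (d /\<^sub>R norm d)
        = (u \<bullet> d + w \<bullet> d) / norm d * (sqrt 2 / 2)"
      by (simp add: inner_add_left field_simps)
    also have "\<dots> > cos (pi / 4) \<longleftrightarrow> (u \<bullet> d + w \<bullet> d) / norm d > 1"
      unfolding cos_45 mult_less_cancel_right1 by simp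
    also have "\<dots> \<longleftrightarrow> u \<bullet> d + w \<bullet> d > norm d"
      using pos by (simp add: field_simps)
    also have "\<dots> \<longleftrightarrow> u \<bullet> d > 0 \<and> w \<bullet> d > 0"
      by (rule sum_gt_hypotenuse_iff) (use pars in auto)
    finally show ?thesis by (simp add: d_def mem_corner inner_diff_right)
  qed
qed

text \<open>The vectors run cyclically through \<open>b1\<close>, \<open>b2\<close>,
  \<open>- b1\<close>, \<open>- b2\<close>, so that the cone of index \<open>j\<close> has its sides
  along two consecutive ones and all four cones are treated alike.\<close>

definition frame :: "real \<Rightarrow> nat \<Rightarrow> real ^ 2" where
  "frame \<theta> j = (quarter_turn ^^ j) (b1 \<theta>)"

lemma norm_frame [simp]: "norm (frame \<theta> j) = 1"
  by (induction j) (simp_all add: frame_def norm_b1)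

lemma quarter_turn_frame: "quarter_turn (frame \<theta> j) = frame \<theta> (Suc j)"
  by (simp add: frame_def)

lemma inner_frame_Suc: "frame \<theta> j \<bullet> frame \<theta> (Suc j) = 0"
  by (simp flip: quarter_turn_frame)

lemma axis_dir_eq: "axis_dir \<theta> = (sqrt 2 / 2) *\<^sub>R (b1 \<theta> + b2 \<theta>)"
proof -
  have "norm (b1 \<theta> + b2 \<theta>) = sqrt 2"
    by (rule norm_eq_sqrt_inner[THEN trans])
      (use norm_b1[of \<theta>] in
        \<open>simp add: inner_add_left inner_add_right norm_eq_1 flip: quarter_turn_b1\<close>)
  moreover have "inverse (sqrt 2) = sqrt 2 / (2::real)" by (simp add: field_simps)
  ultimately show ?thesis by (simp add: axis_dir_def)
qed

lemma quarter_turn_pow_axis_dir: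
  "(quarter_turn ^^ j) (axis_dir \<theta>) = (sqrt 2 / 2) *\<^sub>R (frame \<theta> j + frame \<theta> (Suc j))"
  by (induction j)
    (simp_all add: axis_dir_eq frame_def quarter_turn_b1 quarter_turn_scaleR quarter_turn_add)

lemma quadrant_eq_corner: "quadrant \<theta> j x = corner (frame \<theta> j) (frame \<theta> (Suc j)) x"
  unfolding quadrant_def quarter_turn_pow_axis_dir
  using open_quadrant_eq_corner[of "frame \<theta> j" x] by (simp only: quarter_turn_frame norm_frame)

lemma frame_values:
  "frame \<theta> 0 = b1 \<theta>" "frame \<theta> 1 = b2 \<theta>" "frame \<theta> 2 = - b1 \<theta>" "frame \<theta> 3 = - b2 \<theta>" "frame \<theta> 4 = b1 \<theta>"
  by (simp_all add: frame_def numeral_eq_Suc quarter_turn_b1 quarter_turn_b2)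

text \<open>The four closed quadrants cover the plane. This will select the cone that matches the
  normal of a separating line.\<close>

lemma ex_frame_nonneg: "\<exists>j\<in>{0,1,2,3}. frame \<theta> j \<bullet> v \<ge> 0 \<and> frame \<theta> (Suc j) \<bullet> v \<ge> 0"
proof -
  have "Suc 0 = 1" "Suc 1 = 2" "Suc 2 = 3" "Suc 3 = 4" by simp_all
  then show ?thesis
    by (simp only: bex_simps frame_values inner_minus_left) linarith
qed

lemma maximal_empty_cone_minus [simp]: "maximal_empty_cone A (- d) C = maximal_empty_cone A d C"
proof -
  have "maximal_empty_cone A (- d) C \<subseteq> maximal_empty_cone A d C" for d
    unfolding maximal_empty_cone_def
  proof (intro Union_mono subsetI)
    fix D
    assume "D \<in> {(+) (t *\<^sub>R - d) ` C |t. C \<subseteq> (+) (t *\<^sub>R - d) ` C \<and> (+) (t *\<^sub>R - d) ` C \<inter> A = {}}"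
    then obtain t where "D = (+) (t *\<^sub>R - d) ` C" "C \<subseteq> D" "D \<inter> A = {}" by blast
    then show "D \<in> {(+) (t *\<^sub>R d) ` C |t. C \<subseteq> (+) (t *\<^sub>R d) ` C \<and> (+) (t *\<^sub>R d) ` C \<inter> A = {}}"
      by (intro CollectI exI[of _ "- t"]) simp
  qed
  from this[of d] this[of "- d"] show ?thesis by simp
qed

text \<open>Up to sign and order, two consecutive frame vectors are \<open>b1 \<theta>\<close> and
  \<open>b2 \<theta>\<close>, and the sign of the direction is immaterial.\<close>

lemma maximal_empty_cones_frame:
  assumes "j \<in> {0,1,2,3}"
  shows "maximal_empty_cone A (b1 \<theta>) C \<union> maximal_empty_cone A (b2 \<theta>) C
    = maximal_empty_cone A (frame \<theta> j) C \<union> maximal_empty_cone A (frame \<theta> (Suc j)) C"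
proof -
  have "Suc 0 = 1" "Suc 1 = 2" "Suc 2 = 3" "Suc 3 = 4" by simp_all
  with assms show ?thesis by (auto simp only: frame_values maximal_empty_cone_minus)
qed

section \<open>Empty corners with vertex at a sample point\<close>

lemma finite_inner_argmax:
  fixes u :: "'a::real_inner"
  assumes "finite B" "B \<noteq> {}"
  obtains p where "p \<in> B" "\<And>a. a \<in> B \<Longrightarrow> u \<bullet> a \<le> u \<bullet> p"
proof -
  have "Max (inner u ` B) \<in> inner u ` B" using assms by simp
  then obtain p where "p \<in> B" "u \<bullet> p = Max (inner u ` B)" by auto
  then show ?thesis using assms by (intro that[of p]) simp_all
qed

lemma convex_hull_inner_ge:
  assumes "z \<in> convex hull A"
  obtains p where "p \<in> A" "w \<bullet> z \<le> w \<bullet> p"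
proof (cases "\<exists>p\<in>A. w \<bullet> z \<le> w \<bullet> p")
  case False
  then have "A \<subseteq> {x. w \<bullet> x < w \<bullet> z}" by auto
  then have "convex hull A \<subseteq> {x. w \<bullet> x < w \<bullet> z}"
    by (intro hull_minimal convex_halfspace_lt)
  with assms show ?thesis by auto
qed (use that in blast)

text \<open>The two bounds on \<open>p\<close> are kept in the conclusion because exchanging
  \<open>u\<close> and \<open>w\<close> reverses them, which forces the two points obtained to be
  distinct.\<close>

lemma empty_corner_reached:
  fixes u w :: "real ^ 2"
  assumes fin: "finite A" and z: "z \<in> convex hull A"
    and zy: "z \<in> corner u w y" and em: "corner u w y \<inter> A = {}"
    and orth: "u \<bullet> w = 0" and w: "norm w = 1"
  obtains p where "p \<in> A" "u \<bullet> p \<le> u \<bullet> y" "w \<bullet> p > w \<bullet> y" "corner u w p \<inter> A = {}"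
    "z \<in> maximal_empty_cone A w (corner u w p)"
proof -
  define B where "B = {a \<in> A. w \<bullet> a > w \<bullet> y}"
  \<comment> \<open>Here membership in the convex hull matters: some sample point is at least as
    high as \<open>z\<close>, hence above \<open>y\<close>.\<close>
  obtain a where "a \<in> A" "w \<bullet> z \<le> w \<bullet> a" using convex_hull_inner_ge[OF z] by blast
  then have "B \<noteq> {}" using zy by (force simp: B_def mem_corner)
  moreover have "finite B" using fin by (simp add: B_def)
  ultimately obtain p where p: "p \<in> B" and max: "\<And>a. a \<in> B \<Longrightarrow> u \<bullet> a \<le> u \<bullet> p"
    using finite_inner_argmax by blast
  \<comment> \<open>The shift is negative and brings the vertex from \<open>p\<close> down to the
    level of \<open>y\<close>.\<close>
  define t where "t = w \<bullet> y - w \<bullet> p"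
  have t: "u \<bullet> (t *\<^sub>R w + p) = u \<bullet> p" "w \<bullet> (t *\<^sub>R w + p) = w \<bullet> y"
    using orth w by (simp_all add: inner_add_right t_def norm_eq_1)
  have pB: "p \<in> A" "w \<bullet> p > w \<bullet> y" using p by (auto simp: B_def)
  \<comment> \<open>Otherwise \<open>p\<close> itself would lie in the empty corner at
    \<open>y\<close>.\<close>
  then have py: "u \<bullet> p \<le> u \<bullet> y" using em by (force simp: mem_corner)
  have sub: "corner u w p \<subseteq> corner u w (t *\<^sub>R w + p)"
    using pB by (auto simp: mem_corner t)
  \<comment> \<open>A sample point in the lowered corner would belong to \<open>B\<close> and lie
    further along \<open>u\<close> than \<open>p\<close>.\<close>
  have em': "corner u w (t *\<^sub>R w + p) \<inter> A = {}"
    using max by (force simp: mem_corner t B_def)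
  have "z \<in> corner u w (t *\<^sub>R w + p)"
    using zy py by (auto simp: mem_corner t)
  then have "z \<in> maximal_empty_cone A w (corner u w p)"
    using sub em' unfolding maximal_empty_cone_def translate_corner by blast
  moreover have "corner u w p \<inter> A = {}" using sub em' by blast
  ultimately show ?thesis using that pB py by blast
qed

section \<open>Comparison of the biconvex hull with the convex hull and the removed cones\<close>

lemma biconvex_hull_subset_convex_hull:
  assumes "finite A"
  shows "biconvex_hull \<theta> A \<subseteq> convex hull A"
proof (rule ccontr)
  assume "\<not> ?thesis"
  then obtain z where z: "z \<in> biconvex_hull \<theta> A" "z \<notin> convex hull A" by blast
  have "closed (convex hull A)"
    using assms by (simp add: compact_imp_closed finite_imp_compact_convex_hull)
  then obtain v' b where v': "v' \<bullet> z < b" "\<And>x. x \<in> convex hull A \<Longrightarrow> v' \<bullet> x > b"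
    using separating_hyperplane_closed_point[OF convex_convex_hull _ z(2)] by blast
  \<comment> \<open>The sign is reversed so that \<open>v\<close> points from the sample towards
    \<open>z\<close>.\<close>
  define v where "v = - v'"
  have v: "v \<bullet> z > - b" "\<And>x. x \<in> A \<Longrightarrow> v \<bullet> x < - b"
    using v' by (auto simp: v_def hull_inc)
  obtain j where j: "j \<in> {0,1,2,3}" "frame \<theta> j \<bullet> v \<ge> 0" "frame \<theta> (Suc j) \<bullet> v \<ge> 0"
    using ex_frame_nonneg by blast
  define u w where "u = frame \<theta> j" and "w = frame \<theta> (Suc j)"
  have uw: "norm u = 1" "norm w = 1" "u \<bullet> w = 0" "w = quarter_turn u"
    by (auto simp: u_def w_def inner_frame_Suc quarter_turn_frame)
  have uv: "u \<bullet> v \<ge> 0" "w \<bullet> v \<ge> 0" using j by (auto simp: u_def w_def)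
  \<comment> \<open>The summand 1 makes \<open>s\<close> positive and leaves a margin: moving back
    from \<open>z\<close> to \<open>y\<close> keeps \<open>v \<bullet> y\<close> above
    \<open>- b\<close> by exactly \<open>\<epsilon>\<close>.\<close>
  define s where "s = u \<bullet> v + w \<bullet> v + 1"
  define \<epsilon> where "\<epsilon> = (v \<bullet> z + b) / s"
  have s: "s > 0" using uv by (simp add: s_def)
  have \<epsilon>: "\<epsilon> > 0" using s v(1) by (simp add: \<epsilon>_def)
  define y where "y = z - \<epsilon> *\<^sub>R (u + w)"
  have uw': "w \<bullet> u = 0" using uw(3) by (simp add: inner_commute)
  have zy: "z \<in> corner u w y"
    using \<epsilon> uw(1-3) uw' by (simp add: mem_corner y_def inner_diff_right inner_add_right norm_eq_1)
  have "v \<bullet> y = v \<bullet> z - \<epsilon> * (s - 1)"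
    by (simp add: y_def s_def inner_diff_right inner_add_right inner_commute algebra_simps)
  also have "\<dots> = - b + \<epsilon>" using s by (simp add: \<epsilon>_def field_simps)
  finally have vy: "v \<bullet> y > - b" using \<epsilon> by simp
  have "corner u w y \<inter> A = {}"
  proof (rule ccontr)
    assume "corner u w y \<inter> A \<noteq> {}"
    then obtain a where a: "a \<in> A" "u \<bullet> (a - y) > 0" "w \<bullet> (a - y) > 0"
      by (auto simp: mem_corner inner_diff_right)
    \<comment> \<open>Both \<open>v\<close> and \<open>a - y\<close> have nonnegative coordinates in
      this frame, so \<open>a\<close> would be on the same side of the line as
      \<open>y\<close>.\<close>
    have "v \<bullet> (a - y) = (u \<bullet> v) * (u \<bullet> (a - y)) + (w \<bullet> v) * (w \<bullet> (a - y))"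
      unfolding uw(4) by (rule inner_frame_expand[OF uw(1)])
    also have "\<dots> \<ge> 0" using a uv by simp
    finally show False using v(2)[OF a(1)] vy by (simp add: inner_diff_right)
  qed
  then have "z \<notin> biconvex_hull \<theta> A"
    using zy j(1) unfolding biconvex_hull_def u_def w_def quadrant_eq_corner by blast
  with z show False by blast
qed

text \<open>Every translate in the union is itself an empty quadrant of index \<open>j\<close>,
  hence one of those excluded from the hull.\<close>

lemma maximal_empty_cone_quadrant_disjoint_hull:
  assumes "j \<in> {0,1,2,3}"
  shows "maximal_empty_cone A d (quadrant \<theta> j x) \<inter> biconvex_hull \<theta> A = {}"
  using assms unfolding maximal_empty_cone_def biconvex_hull_def quadrant_eq_corner translate_corner
  by blast

text \<open>What one step subtracts does not depend on the current set \<open>E\<close>, so the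
  nested loops collapse to a single set difference.\<close>

definition removed_set :: "real \<Rightarrow> (real ^ 2) set \<Rightarrow> real ^ 2 \<Rightarrow> nat \<Rightarrow> (real ^ 2) set" where
  "removed_set \<theta> A x j =
     (let C = quadrant \<theta> j x in
      if C \<inter> A = {} then maximal_empty_cone A (b1 \<theta>) C \<union> maximal_empty_cone A (b2 \<theta>) C else {})"

lemma cone_removal_eq: "cone_removal \<theta> A x j E = E - removed_set \<theta> A x j"
  by (auto simp: cone_removal_def removed_set_def Let_def)

lemma fold_diff_eq: "fold (\<lambda>i E. E - R i) xs E = E - (\<Union>i\<in>set xs. R i)"
  by (induction xs arbitrary: E) auto

lemma algorithm_output_eq:
  "algorithm_output \<theta> n X = convex hull (X ` {1..n})
    - (\<Union>i\<in>{1..<n}. \<Union>j\<in>{0,1,2,3}. removed_set \<theta> (X ` {1..n}) (X i) j)"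
proof -
  have *: "cone_removal \<theta> A x = (\<lambda>j E. E - removed_set \<theta> A x j)" for A x
    by (simp add: cone_removal_eq fun_eq_iff)
  show ?thesis
    unfolding algorithm_output_def Let_def * fold_diff_eq by simp
qed

theorem theorem5:
  fixes S :: "(real ^ 2) set" and n :: nat and X :: "nat \<Rightarrow> real ^ 2" and \<theta> :: real
  assumes "compact S"
    and "path_connected (frontier S)"
    and "S = closure (interior S)"
    and "inj_on X {1..n}"
    and "X ` {1..n} \<subseteq> S"
    and "0 \<le> \<theta>" and "\<theta> < pi / 2"
  shows "algorithm_output \<theta> n X = biconvex_hull \<theta> (X ` {1..n})"
proof
  let ?A = "X ` {1..n}"
  have "removed_set \<theta> ?A (X i) j \<inter> biconvex_hull \<theta> ?A = {}" if "j \<in> {0,1,2,3}" for i j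
    unfolding removed_set_def Let_def
    using maximal_empty_cone_quadrant_disjoint_hull[OF that] by (simp add: Int_Un_distrib2)
  then show "biconvex_hull \<theta> ?A \<subseteq> algorithm_output \<theta> n X"
    using biconvex_hull_subset_convex_hull[of ?A \<theta>] unfolding algorithm_output_eq by blast
  show "algorithm_output \<theta> n X \<subseteq> biconvex_hull \<theta> ?A"
  proof (rule ccontr)
    assume "\<not> ?thesis"
    then obtain z where z: "z \<in> algorithm_output \<theta> n X" "z \<notin> biconvex_hull \<theta> ?A" by blast
    then obtain j y where j: "j \<in> {0,1,2,3}" and y: "z \<in> quadrant \<theta> j y" "quadrant \<theta> j y \<inter> ?A = {}"
      unfolding biconvex_hull_def by blast
    define u w where "u = frame \<theta> j" and "w = frame \<theta> (Suc j)"
    have uw: "norm u = 1" "norm w = 1" "u \<bullet> w = 0" "w \<bullet> u = 0"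
      using inner_frame_Suc[of \<theta> j] by (auto simp: u_def w_def inner_commute)
    have quad: "quadrant \<theta> j x = corner u w x" for x
      by (simp add: quadrant_eq_corner u_def w_def)
    have z_hull: "z \<in> convex hull ?A" using z(1) by (simp add: algorithm_output_eq)
    obtain p where p: "p \<in> ?A" "u \<bullet> p \<le> u \<bullet> y" "w \<bullet> p > w \<bullet> y" "corner u w p \<inter> ?A = {}"
        "z \<in> maximal_empty_cone ?A w (corner u w p)"
      using empty_corner_reached[OF _ z_hull] y uw unfolding quad by blast
    \<comment> \<open>The same lemma with the two coordinates exchanged.\<close>
    obtain q where q: "q \<in> ?A" "w \<bullet> q \<le> w \<bullet> y" "u \<bullet> q > u \<bullet> y" "corner w u q \<inter> ?A = {}"
        "z \<in> maximal_empty_cone ?A u (corner w u q)"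
      using empty_corner_reached[OF _ z_hull] y uw unfolding quad corner_commute[of u w] by blast
    \<comment> \<open>The cone at \<open>p\<close> reaches \<open>z\<close> by sliding along
      \<open>w\<close>, the one at \<open>q\<close> along \<open>u\<close>; the algorithm subtracts
      both translates.\<close>
    have removed: "z \<in> removed_set \<theta> ?A x j" if "x \<in> {p, q}" for x
      using that p(4,5) q(4,5) maximal_empty_cones_frame[OF j, of ?A \<theta> "quadrant \<theta> j x"]
      by (auto simp: removed_set_def Let_def quad corner_commute[of w u] simp flip: u_def w_def)
    have "p \<noteq> q" using p(2) q(3) by auto
    then obtain x where "x \<in> {p, q}" "x \<noteq> X n" by blast
    moreover obtain i where "i \<in> {1..n}" "x = X i" using p(1) q(1) \<open>x \<in> {p, q}\<close> by blast
    ultimately have "i \<in> {1..<n}" "z \<in> removed_set \<theta> ?A (X i) j"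
      using removed by (auto simp: less_le)
    then show False using z(1) j unfolding algorithm_output_eq by blast
  qed
qed

end
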